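(* Let $p$ be an odd prime and $k$ a field of characteristic $p$. Let $r>s\ge 1$ be integers and let $m=\gcd(r,s)$. Then the degree of the field $S$ over the field $k(N_{p^r+1},N_{p^s+1},N_1)$ is $$[S:k(N_{p^r+1},N_{p^s+1},N_1)]=\begin{cases}1 & \text{if } 2m\nmid (r-s),\\[2pt] \dfrac{p^m+1}{2} & \text{if } 2m\mid (r-s).\end{cases}$$
   Context: $F=k(x,y)$ is the field of rational functions in two algebraically independent transcendentals $x,y$ over $k$, and $S\subset F$ is the subfield of symmetric functions, i.e. the elements of $F$ fixed by the $k$-automorphism exchanging $x$ and $y$. For $j\ge 1$, $N_j=x^j+y^j$, and $k(N_{p^r+1},N_{p^s+1},N_1)$ is the subfield of $F$ generated over $k$ by these three polynomials. *)

theory Defs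
  imports "HOL-Algebra.Algebraic_Closure_Type" "HOL-Algebra.Generated_Fields"
    "HOL-Algebra.Embedded_Algebras"
begin

text \<open>
  The field \<open>F = k(x, y)\<close> is the fraction field of \<open>k[x][y]\<close>. The indeterminate of the inner
  polynomial ring is \<open>x\<close>, that of the outer one is \<open>y\<close>.
\<close>

type_synonym 'k ratfun2 = "'k poly poly fract"

abbreviation (input) ratfun2_field :: "'k::field ratfun2 ring"
  where "ratfun2_field \<equiv> ring_of_type_algebra"

definition ratfun2_const :: "'k::field \<Rightarrow> 'k ratfun2"
  where "ratfun2_const c = to_fract [:[:c:]:]"

definition ratfun2_X :: "'k::field ratfun2"
  where "ratfun2_X = to_fract [:[:0, 1:]:]"

definition ratfun2_Y :: "'k::field ratfun2"
  where "ratfun2_Y = to_fract [:0, 1:]"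

definition is_exchange_automorphism :: "('k::field ratfun2 \<Rightarrow> 'k ratfun2) \<Rightarrow> bool"
  where "is_exchange_automorphism \<sigma> \<longleftrightarrow>
    \<sigma> \<in> ring_iso ratfun2_field ratfun2_field \<and>
    (\<forall>c. \<sigma> (ratfun2_const c) = ratfun2_const c) \<and>
    \<sigma> ratfun2_X = ratfun2_Y \<and> \<sigma> ratfun2_Y = ratfun2_X"

text \<open>Well-defined by \<open>ex1_exchange_automorphism\<close> below.\<close>

definition exchange_automorphism :: "'k::field ratfun2 \<Rightarrow> 'k ratfun2"
  where "exchange_automorphism = (THE \<sigma>. is_exchange_automorphism \<sigma>)"

definition symmetric_ratfuns :: "'k::field ratfun2 set"
  where "symmetric_ratfuns = {f. exchange_automorphism f = f}"

definition power_sum2 :: "nat \<Rightarrow> 'k::field ratfun2"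
  where "power_sum2 j = ratfun2_X ^ j + ratfun2_Y ^ j"

definition adjoin :: "'k::field ratfun2 set \<Rightarrow> 'k ratfun2 set"
  where "adjoin A = generate_field ratfun2_field (range ratfun2_const \<union> A)"


subsection \<open>Existence and uniqueness of the exchange automorphism\<close>

lemma ring_of_type_algebra_simps:
  "carrier ring_of_type_algebra = UNIV"
  "x \<otimes>\<^bsub>ring_of_type_algebra\<^esub> y = x * y"
  "x \<oplus>\<^bsub>ring_of_type_algebra\<^esub> y = x + y"
  "\<one>\<^bsub>ring_of_type_algebra\<^esub> = 1"
  "\<zero>\<^bsub>ring_of_type_algebra\<^esub> = 0"
  by (simp_all add: ring_of_type_algebra_def)

lemma is_exchange_automorphism_alt:
  "is_exchange_automorphism \<sigma> \<longleftrightarrow>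
    bij \<sigma> \<and> \<sigma> 1 = 1 \<and> (\<forall>a b. \<sigma> (a + b) = \<sigma> a + \<sigma> b) \<and> (\<forall>a b. \<sigma> (a * b) = \<sigma> a * \<sigma> b) \<and>
    (\<forall>c. \<sigma> (ratfun2_const c) = ratfun2_const c) \<and>
    \<sigma> ratfun2_X = ratfun2_Y \<and> \<sigma> ratfun2_Y = ratfun2_X"
  by (auto simp: is_exchange_automorphism_def ring_iso_def ring_hom_def ring_of_type_algebra_simps)

definition comm_ring_hom :: "('a::comm_ring_1 \<Rightarrow> 'b::comm_ring_1) \<Rightarrow> bool"
  where "comm_ring_hom h \<longleftrightarrow>
    h 1 = 1 \<and> (\<forall>a b. h (a + b) = h a + h b) \<and> (\<forall>a b. h (a * b) = h a * h b)"

lemma comm_ring_hom_0: "comm_ring_hom h \<Longrightarrow> h 0 = 0"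
  unfolding comm_ring_hom_def by (metis add_cancel_right_right)

lemma comm_ring_hom_eval:
  assumes "comm_ring_hom h"
  shows "comm_ring_hom (\<lambda>p. poly (map_poly h p) b)"
proof -
  have h0: "h 0 = 0" by (rule comm_ring_hom_0[OF assms])
  have h1: "h 1 = 1" and ha: "\<And>a b. h (a + b) = h a + h b" and hm: "\<And>a b. h (a * b) = h a * h b"
    using assms by (auto simp: comm_ring_hom_def)
  have add: "map_poly h (p + q) = map_poly h p + map_poly h q" for p q
    by (rule poly_eqI) (simp add: coeff_map_poly h0 ha)
  have smult: "map_poly h (smult a p) = smult (h a) (map_poly h p)" for a p
    by (rule poly_eqI) (simp add: coeff_map_poly h0 hm)
  have pCons: "map_poly h (pCons a p) = pCons (h a) (map_poly h p)" for a p
    by (rule poly_eqI) (simp add: coeff_map_poly h0 coeff_pCons split: nat.splits)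
  have mult: "map_poly h (p * q) = map_poly h p * map_poly h q" for p q
    by (induction p) (simp_all add: add smult pCons h0)
  show ?thesis
    unfolding comm_ring_hom_def by (simp add: add mult map_poly_1' h1)
qed

lemma comm_ring_hom_comp: "comm_ring_hom f \<Longrightarrow> comm_ring_hom g \<Longrightarrow> comm_ring_hom (\<lambda>x. f (g x))"
  by (simp add: comm_ring_hom_def)

definition swap_poly2 :: "'k::field poly poly \<Rightarrow> 'k poly poly"
  where "swap_poly2 p =
    poly (map_poly (\<lambda>c. poly (map_poly (\<lambda>a. [:[:a:]:]) c) [:0, 1:]) p) [:[:0, 1:]:]"

lemma comm_ring_hom_swap_poly2: "comm_ring_hom swap_poly2"
proof -
  have "comm_ring_hom (\<lambda>a::'k::field. [:[:a:]:])"
    by (simp add: comm_ring_hom_def one_pCons)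
  from comm_ring_hom_eval[OF comm_ring_hom_eval[OF this]] show ?thesis
    unfolding swap_poly2_def[abs_def] .
qed

lemma swap_poly2_simps:
  "swap_poly2 [:[:c:]:] = [:[:c:]:]"
  "swap_poly2 [:[:0, 1:]:] = [:0, 1:]"
  "swap_poly2 [:0, 1:] = [:[:0, 1:]:]"
  by (simp_all add: swap_poly2_def map_poly_pCons map_poly_1' flip: one_pCons)

text \<open>A ring homomorphism on \<open>k[x][y]\<close> is determined by its values on \<open>k\<close>, \<open>x\<close> and \<open>y\<close>.\<close>

lemma comm_ring_hom_poly2_eqI:
  fixes f g :: "'k::field poly poly \<Rightarrow> 'b::comm_ring_1"
  assumes f: "comm_ring_hom f" and g: "comm_ring_hom g"
    and c: "\<And>c. f [:[:c:]:] = g [:[:c:]:]"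
    and X: "f [:[:0, 1:]:] = g [:[:0, 1:]:]" and Y: "f [:0, 1:] = g [:0, 1:]"
  shows "f p = g p"
proof -
  have fa: "\<And>a b. f (a + b) = f a + f b" and fm: "\<And>a b. f (a * b) = f a * f b"
    and ga: "\<And>a b. g (a + b) = g a + g b" and gm: "\<And>a b. g (a * b) = g a * g b"
    using f g by (auto simp: comm_ring_hom_def)
  have f0: "f 0 = g 0" using f g by (simp add: comm_ring_hom_0)
  have inner: "f [:q:] = g [:q:]" for q
  proof (induction q)
    case 0
    then show ?case using f0 by simp
  next
    case (pCons a q)
    have "[:pCons a q:] = [:[:a:]:] + [:[:0, 1:]:] * [:q:]" by simp
    then show ?case using pCons c X by (simp only: fa fm ga gm)
  qed
  show ?thesis
  proof (induction p)
    case 0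
    then show ?case using f0 by simp
  next
    case (pCons a p)
    have "pCons a p = [:a:] + [:0, 1:] * p" by simp
    then show ?case using pCons inner Y by (simp only: fa fm ga gm)
  qed
qed

lemma swap_poly2_swap_poly2: "swap_poly2 (swap_poly2 p) = p"
  by (rule comm_ring_hom_poly2_eqI[where f = "\<lambda>p. swap_poly2 (swap_poly2 p)" and g = "\<lambda>p. p"])
     (simp_all add: comm_ring_hom_comp comm_ring_hom_swap_poly2 swap_poly2_simps,
      simp add: comm_ring_hom_def)

lemma swap_poly2_0_iff: "swap_poly2 p = 0 \<longleftrightarrow> p = 0"
  by (metis comm_ring_hom_0 comm_ring_hom_swap_poly2 swap_poly2_swap_poly2)

definition swap_ratfun2 :: "'k::field ratfun2 \<Rightarrow> 'k ratfun2"
  where "swap_ratfun2 q =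
    (THE r. \<forall>a b. b \<noteq> 0 \<longrightarrow> q = Fract a b \<longrightarrow> r = Fract (swap_poly2 a) (swap_poly2 b))"

lemma swap_ratfun2_Fract:
  assumes "b \<noteq> 0"
  shows "swap_ratfun2 (Fract a b) = Fract (swap_poly2 a) (swap_poly2 b)"
proof -
  have "Fract (swap_poly2 a) (swap_poly2 b) = Fract (swap_poly2 c) (swap_poly2 d)"
    if "d \<noteq> 0" "Fract a b = Fract c d" for c d
  proof -
    have "a * d = c * b" using that assms by (simp add: eq_fract)
    then have "swap_poly2 a * swap_poly2 d = swap_poly2 c * swap_poly2 b"
      using comm_ring_hom_swap_poly2 by (metis comm_ring_hom_def)
    then show ?thesis using that assms by (simp add: eq_fract swap_poly2_0_iff)
  qed
  then show ?thesis
    unfolding swap_ratfun2_def using assms by (intro the_equality) blast+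
qed

lemma is_exchange_automorphism_swap_ratfun2:
  "is_exchange_automorphism (swap_ratfun2 :: 'k::field ratfun2 \<Rightarrow> 'k ratfun2)"
proof -
  have hom: "swap_poly2 1 = 1" "\<And>a b. swap_poly2 (a + b) = swap_poly2 a + swap_poly2 b"
    "\<And>a b. swap_poly2 (a * b) = swap_poly2 a * swap_poly2 b"
    using comm_ring_hom_swap_poly2 by (auto simp: comm_ring_hom_def)
  have "swap_ratfun2 (swap_ratfun2 q) = q" for q :: "'k ratfun2"
    by (cases q) (simp add: swap_ratfun2_Fract swap_poly2_swap_poly2 swap_poly2_0_iff)
  then have "bij (swap_ratfun2 :: 'k ratfun2 \<Rightarrow> _)"
    by (rule involuntory_imp_bij)
  moreover have "swap_ratfun2 (a + b) = swap_ratfun2 a + swap_ratfun2 b" for a b :: "'k ratfun2"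
    by (cases a; cases b) (simp add: swap_ratfun2_Fract hom swap_poly2_0_iff)
  moreover have "swap_ratfun2 (a * b) = swap_ratfun2 a * swap_ratfun2 b" for a b :: "'k ratfun2"
    by (cases a; cases b) (simp add: swap_ratfun2_Fract hom swap_poly2_0_iff)
  ultimately show ?thesis
    unfolding is_exchange_automorphism_alt
    by (simp add: ratfun2_const_def ratfun2_X_def ratfun2_Y_def to_fract_def One_fract_def
        swap_ratfun2_Fract hom swap_poly2_simps)
qed

lemma ex1_exchange_automorphism:
  "\<exists>!\<sigma> :: 'k::field ratfun2 \<Rightarrow> 'k ratfun2. is_exchange_automorphism \<sigma>"
proof (rule ex1I)
  show "is_exchange_automorphism (swap_ratfun2 :: 'k ratfun2 \<Rightarrow> _)"
    by (rule is_exchange_automorphism_swap_ratfun2)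
next
  fix \<sigma> :: "'k ratfun2 \<Rightarrow> 'k ratfun2"
  assume \<sigma>: "is_exchange_automorphism \<sigma>"
  let ?\<tau> = "swap_ratfun2 :: 'k ratfun2 \<Rightarrow> _"
  have \<tau>: "is_exchange_automorphism ?\<tau>" by (rule is_exchange_automorphism_swap_ratfun2)
  have eq: "\<sigma> (to_fract p) = ?\<tau> (to_fract p)" for p
  proof (rule comm_ring_hom_poly2_eqI[where f = "\<lambda>p. \<sigma> (to_fract p)" and g = "\<lambda>p. ?\<tau> (to_fract p)"])
    have "comm_ring_hom (to_fract :: 'k poly poly \<Rightarrow> _)" by (simp add: comm_ring_hom_def)
    then show "comm_ring_hom (\<lambda>p. \<sigma> (to_fract p))" "comm_ring_hom (\<lambda>p. ?\<tau> (to_fract p))"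
      using \<sigma> \<tau> by (auto intro!: comm_ring_hom_comp simp: comm_ring_hom_def is_exchange_automorphism_alt)
  qed (use \<sigma> \<tau> in \<open>auto simp: is_exchange_automorphism_alt ratfun2_const_def ratfun2_X_def ratfun2_Y_def\<close>)
  show "\<sigma> = ?\<tau>"
  proof
    fix q :: "'k ratfun2"
    obtain a b where q: "q = Fract a b" "b \<noteq> 0" by (cases q)
    have b: "q * to_fract b = to_fract a" 
      using q by (simp add: to_fract_def eq_fract)
    have "\<sigma> q * \<sigma> (to_fract b) = \<sigma> (to_fract a)"
      using \<sigma> b by (metis is_exchange_automorphism_alt)
    moreover have "?\<tau> q * ?\<tau> (to_fract b) = ?\<tau> (to_fract a)"
      using \<tau> b by (metis is_exchange_automorphism_alt)
    moreover have "?\<tau> (to_fract b) \<noteq> 0"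
      using q by (simp add: to_fract_def swap_ratfun2_Fract swap_poly2_0_iff
          Zero_fract_def eq_fract)
    ultimately show "\<sigma> q = ?\<tau> q" using eq by (metis mult_right_cancel)
  qed
qed

lemma is_exchange_automorphism_exchange_automorphism:
  "is_exchange_automorphism exchange_automorphism"
  unfolding exchange_automorphism_def by (rule theI'[OF ex1_exchange_automorphism])

end

theory Submission
  imports Defs "HOL-Number_Theory.Cong"
begin

text \<open>
  Put \<open>u = x + y\<close> and \<open>v = x - y\<close>. By the Frobenius identity,
  \<open>2 N\<^bsub>q+1\<^esub> = u\<^bsup>q+1\<^esup> + v\<^bsup>q+1\<^esup>\<close> for every power \<open>q\<close> of \<open>p\<close>, so the field
  generated by the three power sums is \<open>K = k(u, v\<^bsup>d\<^esup>)\<close> with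
  \<open>d = gcd (p\<^sup>r + 1) (p\<^sup>s + 1) = 2n\<close>. As the exchange automorphism fixes \<open>u\<close> and negates \<open>v\<close>,
  the symmetric functions are \<open>k(u, v\<^sup>2)\<close>, with basis \<open>1, v\<^sup>2, ..., v\<^bsup>2(n-1)\<^esup>\<close> over \<open>K\<close>. These powers
  are linearly independent because the degree in \<open>v\<close> of every nonzero element of \<open>K\<close> is divisible
  by \<open>d\<close>. The integer \<open>d\<close> is \<open>p\<^sup>m + 1\<close> if \<open>r/m\<close> and \<open>s/m\<close> are both odd, and \<open>2\<close> otherwise.
\<close>

section \<open>Fields as rings with an explicit carrier\<close>

text \<open>Makes spans, independence and dimension available for a type-class field. Facts that
  need the locale \<open>field\<close> are taken from
  \<open>field_from_type_algebra\<close>.\<close>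

interpretation type_field: domain "ring_of_type_algebra :: 'a::field ring"
  using field_from_type_algebra by (rule field.axioms(1))

lemma ring_of_type_algebra_uminus: "\<ominus>\<^bsub>ring_of_type_algebra\<^esub> (x :: 'a::field) = - x"
  by (rule type_field.minus_equality) (simp_all add: ring_of_type_algebra_simps)

lemma ring_of_type_algebra_inverse:
  assumes "x \<noteq> 0"
  shows "inv\<^bsub>ring_of_type_algebra\<^esub> (x :: 'a::field) = inverse x"
  by (rule type_field.inv_unique'[symmetric]) (simp_all add: assms ring_of_type_algebra_simps)

lemma ring_of_type_algebra_power: "(x :: 'a::field) [^]\<^bsub>ring_of_type_algebra\<^esub> (n :: nat) = x ^ n"
  by (induction n) (simp_all add: ring_of_type_algebra_simps)

lemmas type_field_simps = ring_of_type_algebra_simps ring_of_type_algebra_uminus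
  ring_of_type_algebra_inverse ring_of_type_algebra_power

text \<open>Since \<open>inverse 0 = 0\<close>, closure under \<open>inverse\<close> can be demanded
  without excluding zero. Membership can then be argued with the type-class operations
  alone.\<close>

lemma subfield_type_iff:
  "subfield H (ring_of_type_algebra :: 'a::field ring) \<longleftrightarrow>
    1 \<in> H \<and> (\<forall>a\<in>H. \<forall>b\<in>H. a + b \<in> H) \<and> (\<forall>a\<in>H. \<forall>b\<in>H. a * b \<in> H) \<and>
    (\<forall>a\<in>H. - a \<in> H) \<and> (\<forall>a\<in>H. inverse a \<in> H)" (is "_ \<longleftrightarrow> ?closed")
proof
  assume H: "subfield H (ring_of_type_algebra :: 'a ring)"
  note ring = subringE[OF subfieldE(1)[OF H], unfolded type_field_simps]
  have "inverse a \<in> H" if "a \<in> H" for a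
  proof (cases "a = 0")
    case False
    then show ?thesis
      using type_field.subfield_m_inv(1)[OF H, of a] that by (simp add: type_field_simps)
  qed (use that in simp)
  with ring(3,5-7) show ?closed by simp
next
  assume ?closed
  then show "subfield H (ring_of_type_algebra :: 'a ring)"
    by (intro field.subfieldI'[OF field_from_type_algebra] type_field.subringI) (auto simp: type_field_simps)
qed

context
  fixes K :: "'a::field set"
  assumes K: "subfield K ring_of_type_algebra"
begin

lemma subfield_one: "1 \<in> K"
  and subfield_add: "\<And>a b. a \<in> K \<Longrightarrow> b \<in> K \<Longrightarrow> a + b \<in> K"
  and subfield_mult: "\<And>a b. a \<in> K \<Longrightarrow> b \<in> K \<Longrightarrow> a * b \<in> K"
  and subfield_uminus: "\<And>a. a \<in> K \<Longrightarrow> - a \<in> K"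
  and subfield_inverse: "\<And>a. a \<in> K \<Longrightarrow> inverse a \<in> K"
  using K by (simp_all add: subfield_type_iff)

lemma subfield_zero: "0 \<in> K"
  using subfield_add[OF subfield_one subfield_uminus[OF subfield_one]] by simp

lemma subfield_diff: "a \<in> K \<Longrightarrow> b \<in> K \<Longrightarrow> a - b \<in> K"
  using subfield_add[OF _ subfield_uminus] by fastforce

lemma subfield_divide: "a \<in> K \<Longrightarrow> b \<in> K \<Longrightarrow> a / b \<in> K"
  using subfield_mult[OF _ subfield_inverse] by (simp add: divide_inverse)

lemma subfield_power: "a \<in> K \<Longrightarrow> a ^ n \<in> K"
  by (induction n) (simp_all add: subfield_one subfield_mult)

text \<open>By Bezout, the power with exponent \<open>gcd i j\<close> is a quotient of a power of
  \<open>a ^ i\<close> by a power of \<open>a ^ j\<close>.\<close>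

lemma subfield_power_gcd:
  assumes "a \<noteq> 0" "a ^ i \<in> K" "a ^ j \<in> K" "i \<noteq> 0"
  shows "a ^ gcd i j \<in> K"
proof -
  obtain x y where "i * x = j * y + gcd i j"
    using bezout_nat[OF \<open>i \<noteq> 0\<close>] by blast
  then have "a ^ (i * x) = a ^ (j * y) * a ^ gcd i j"
    by (simp add: power_add)
  then have "a ^ gcd i j = (a ^ i) ^ x / (a ^ j) ^ y"
    using \<open>a \<noteq> 0\<close> by (simp add: power_mult)
  then show ?thesis
    using assms by (simp add: subfield_divide subfield_power)
qed

text \<open>The element \<open>v\<close> is algebraic over \<open>K\<close>, being a root of X^d -
  v^d, so K[v] is already a field.\<close>

lemma subfield_simple_extension_root:
  assumes "v ^ d \<in> K" "d > 0"
  shows "subfield (type_field.simple_extension K v) ring_of_type_algebra"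
proof -
  \<comment> \<open>Transcendence means that evaluation at \<open>v\<close> is injective; X^d and
    the constant v^d refute this. As \<open>v\<close> may be zero, \<open>normalize\<close> is
    needed to turn the list \<open>[v ^ d]\<close> into a legal polynomial.\<close>
  let ?p = "type_field.monom 1 d" and ?q = "type_field.normalize [v ^ d]"
  have "?p \<in> carrier (univ_poly ring_of_type_algebra K)"
    using type_field.monom_is_polynomial[OF subfieldE(1)[OF K], of 1 d] subfield_one
    by (simp add: univ_poly_def type_field_simps)
  moreover have "?q \<in> carrier (univ_poly ring_of_type_algebra K)"
    using type_field.normalize_gives_polynomial[of "[v ^ d]" K] assms
    by (simp add: univ_poly_def)
  moreover have "type_field.eval ?p v = type_field.eval ?q v"
    by (simp add: type_field.eval_monom type_field_simps)
  moreover have "length ?p \<noteq> length ?q"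
    using \<open>d > 0\<close> by (simp add: type_field.monom_def)
  ultimately have "\<not> type_field.transcendental K v"
    unfolding type_field.transcendental_def inj_on_def by metis
  then show ?thesis
    using type_field.simple_extension_is_subfield[OF K, of v] by (simp add: over_def type_field_simps)
qed

subsection \<open>Spans of powers\<close>

text \<open>The list \<open>exp_base w n\<close> holds the powers with exponents n-1 down to 0, so
  passing to \<open>Suc n\<close> puts \<open>w ^ n\<close> in front.\<close>

abbreviation "power_span w n \<equiv> type_field.Span K (type_field.exp_base w n)"

lemma power_span_0: "power_span w 0 = {0}"
  by (simp add: type_field.exp_base_def type_field_simps)

lemma power_span_Suc: "f \<in> power_span w (Suc n) \<longleftrightarrow> (\<exists>c\<in>K. \<exists>e\<in>power_span w n. f = c * w ^ n + e)"
  by (simp add: type_field.exp_base_def type_field_simps type_field.line_extension_mem_iff)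

lemma power_span_add: "e \<in> power_span w n \<Longrightarrow> f \<in> power_span w n \<Longrightarrow> e + f \<in> power_span w n"
  using type_field.Span_subgroup_props(3)[OF K, of "type_field.exp_base w n" e f]
  by (simp add: type_field_simps del: type_field.Span.simps)

lemma zero_in_power_span: "0 \<in> power_span w n"
  using type_field.Span_subgroup_props(2)[OF K, of "type_field.exp_base w n"]
  by (simp add: type_field_simps del: type_field.Span.simps)

lemma power_span_mono: "e \<in> power_span w n \<Longrightarrow> e \<in> power_span w (Suc n)"
  unfolding power_span_Suc using subfield_zero by force

lemma scalar_in_power_span: "n > 0 \<Longrightarrow> c \<in> K \<Longrightarrow> c \<in> power_span w n"
proof (induction n)
  case (Suc n)
  show ?case
  proof (cases "n = 0")
    case True
    have "c = c * w ^ 0 + 0" by simp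
    then show ?thesis
      unfolding True power_span_Suc using zero_in_power_span[of w 0] \<open>c \<in> K\<close> by blast
  qed (use Suc in \<open>simp add: power_span_mono del: type_field.Span.simps\<close>)
qed simp

lemma mult_power_span_Suc: "e \<in> power_span w n \<Longrightarrow> w * e \<in> power_span w (Suc n)"
proof (induction n arbitrary: e)
  case 0
  then show ?case by (simp add: power_span_0 zero_in_power_span del: type_field.Span.simps)
next
  case (Suc n)
  then obtain c e' where "c \<in> K" "e' \<in> power_span w n" "e = c * w ^ n + e'"
    unfolding power_span_Suc by blast
  moreover from this have "w * e = c * w ^ Suc n + w * e'"
    by (simp add: algebra_simps)
  ultimately show ?case
    using Suc.IH power_span_Suc[of _ w "Suc n"] by blast
qed

text \<open>Multiplication by \<open>w\<close> only overflows into the term with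
  \<open>w ^ n\<close>, which is a scalar and hence lies in the span again.\<close>

lemma mult_power_span:
  assumes "w ^ n \<in> K" "n > 0" "e \<in> power_span w n"
  shows "w * e \<in> power_span w n"
proof -
  obtain c e' where "c \<in> K" "e' \<in> power_span w n" "w * e = c * w ^ n + e'"
    using mult_power_span_Suc[OF assms(3)] unfolding power_span_Suc by blast
  then show ?thesis
    using assms by (simp add: power_span_add scalar_in_power_span subfield_mult
      del: type_field.Span.simps)
qed

lemma power_span_subset:
  assumes "K \<subseteq> E" "w \<in> E" "subfield E ring_of_type_algebra"
  shows "power_span w n \<subseteq> E"
proof (induction n)
  case 0
  have "0 \<in> E" using assms subfield_zero by blast
  then show ?case by (simp add: power_span_0 del: type_field.Span.simps)
next
  case (Suc n)
  have "1 \<in> E" "\<And>a b. a \<in> E \<Longrightarrow> b \<in> E \<Longrightarrow> a + b \<in> E" "\<And>a b. a \<in> E \<Longrightarrow> b \<in> E \<Longrightarrow> a * b \<in> E"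
    using assms(3) by (simp_all add: subfield_type_iff)
  moreover from this have "w ^ n \<in> E" by (induction n) (simp_all add: assms)
  ultimately show ?case
    using Suc assms(1) unfolding subset_iff power_span_Suc by blast
qed

text \<open>Splits an element of K[v] into its even and odd parts in \<open>v\<close>. The induction
  follows Horner's scheme: multiplying by \<open>v\<close> swaps the two parts.\<close>

lemma simple_extension_even_odd:
  assumes "(v\<^sup>2) ^ n \<in> K" "n > 0" "f \<in> type_field.simple_extension K v"
  shows "\<exists>e\<in>power_span (v\<^sup>2) n. \<exists>e'\<in>power_span (v\<^sup>2) n. f = e + v * e'"
  using assms(3)
proof induction
  case zero
  then show ?case
    using zero_in_power_span[of "v\<^sup>2" n] by (force simp: type_field_simps simp del: type_field.Span.simps)
next
  case (lin f c)
  then obtain e e' where e: "e \<in> power_span (v\<^sup>2) n" "e' \<in> power_span (v\<^sup>2) n" "f = e + v * e'"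
    by blast
  have "v\<^sup>2 * e' + c \<in> power_span (v\<^sup>2) n"
    using e lin assms by (simp add: power_span_add mult_power_span scalar_in_power_span
      del: type_field.Span.simps)
  moreover have "f * v + c = (v\<^sup>2 * e' + c) + v * e"
    by (simp add: e algebra_simps power2_eq_square)
  ultimately show ?case
    unfolding type_field_simps using e(1) by blast
qed

text \<open>Scalars have degree divisible by \<open>n * deg w\<close>, so the terms
  \<open>c * w ^ i\<close> with \<open>i < n\<close> have pairwise incongruent degrees and cannot
  cancel. All that is asked of \<open>deg\<close> is additivity on products and no new value on sums
  of elements of different degree.\<close>

lemma dimension_power_span:
  fixes deg :: "'a \<Rightarrow> int"
  assumes deg_mult: "\<And>a b. a \<noteq> 0 \<Longrightarrow> b \<noteq> 0 \<Longrightarrow> deg (a * b) = deg a + deg b"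
    and deg_add: "\<And>a b. a \<noteq> 0 \<Longrightarrow> b \<noteq> 0 \<Longrightarrow> deg a \<noteq> deg b \<Longrightarrow> deg (a + b) \<in> {deg a, deg b}"
    and deg_K: "\<And>c. c \<in> K \<Longrightarrow> c \<noteq> 0 \<Longrightarrow> int n * deg w dvd deg c"
    and "w \<noteq> 0" "deg w \<noteq> 0"
  shows "type_field.dimension n K (power_span w n)"
proof -
  have deg1: "deg 1 = 0" using deg_mult[of 1 1] by simp
  have deg_power: "deg (w ^ i) = int i * deg w" for i
    by (induction i) (simp_all add: deg1 deg_mult \<open>w \<noteq> 0\<close> algebra_simps)
  have inj: "i = j" if "[int i * deg w = int j * deg w] (mod int n * deg w)" "i < n" "j < n" for i j
  proof -
    have "int n * deg w dvd (int i - int j) * deg w"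
      using that(1) by (simp add: cong_iff_dvd_diff algebra_simps)
    then have "int n dvd int i - int j"
      using \<open>deg w \<noteq> 0\<close> by simp
    then show ?thesis
      using that(2,3) by (metis cong_iff_dvd_diff cong_int_iff cong_less_modulus_unique_nat)
  qed
  have cong: "[deg (c * w ^ i) = int i * deg w] (mod int n * deg w)" if "c \<in> K" "c \<noteq> 0" for c i
    using deg_K[OF that] that \<open>w \<noteq> 0\<close> by (simp add: deg_mult deg_power cong_iff_dvd_diff)
  \<comment> \<open>The claim needed for the induction: a nonzero combination of the first
    \<open>j\<close> powers has the degree of one of its terms, modulo
    \<open>n * deg w\<close>.\<close>
  have span: "e = 0 \<or> (\<exists>i<j. [deg e = int i * deg w] (mod int n * deg w))"
    if "j \<le> n" "e \<in> power_span w j" for e j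
    using that
  proof (induction j arbitrary: e)
    case 0
    then show ?case by (simp add: power_span_0 del: type_field.Span.simps)
  next
    case (Suc j)
    then obtain c e' where c: "c \<in> K" "e' \<in> power_span w j" "e = c * w ^ j + e'"
      unfolding power_span_Suc by blast
    with Suc have IH: "e' = 0 \<or> (\<exists>i<j. [deg e' = int i * deg w] (mod int n * deg w))"
      by simp
    show ?case
    proof (cases "c = 0 \<or> e' = 0")
      case True
      then consider "c = 0" | "c \<noteq> 0" "e' = 0" by blast
      then show ?thesis
      proof cases
        case 1
        then show ?thesis using IH c(3) less_SucI by auto
      next
        case 2
        then show ?thesis using cong[of c j] c(1,3) by auto
      qed
    next
      case False
      then obtain i where i: "i < j" "[deg e' = int i * deg w] (mod int n * deg w)"
        using IH by blast
      have "deg (c * w ^ j) \<noteq> deg e'"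
      proof
        assume "deg (c * w ^ j) = deg e'"
        then have "[int i * deg w = int j * deg w] (mod int n * deg w)"
          using cong[of c j] c False i by (metis cong_sym cong_trans)
        then show False using inj[of i j] i Suc.prems by simp
      qed
      then have "deg e \<in> {deg (c * w ^ j), deg e'}"
        unfolding c(3) using deg_add False \<open>w \<noteq> 0\<close> by simp
      then consider "deg e = deg (c * w ^ j)" | "deg e = deg e'" by blast
      then show ?thesis
      proof cases
        case 1
        then show ?thesis using cong[of c j] c(1) False by auto
      next
        case 2
        then show ?thesis using i by (auto intro!: exI[of _ i])
      qed
    qed
  qed
  have "type_field.independent K (type_field.exp_base w j)" if "j \<le> n" for j
    using that
  proof (induction j)
    case 0
    then show ?case by (simp add: type_field.exp_base_def)
  next
    case (Suc j)
    \<comment> \<open>Otherwise \<open>j\<close> would be congruent modulo \<open>n\<close> to some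
      smaller exponent, although both are below \<open>n\<close>.\<close>
    have "w ^ j \<notin> power_span w j"
    proof
      assume "w ^ j \<in> power_span w j"
      then obtain i where "i < j" "[deg (w ^ j) = int i * deg w] (mod int n * deg w)"
        using span[of j] Suc.prems \<open>w \<noteq> 0\<close> by fastforce
      then show False
        using inj[of j i] Suc.prems by (simp add: deg_power)
    qed
    moreover have "type_field.exp_base w (Suc j) = w ^ j # type_field.exp_base w j"
      by (simp add: type_field.exp_base_def type_field_simps)
    ultimately show ?case
      using Suc type_field.li_Cons[of "w ^ j"] by (simp add: type_field_simps del: type_field.Span.simps)
  qed
  from type_field.dimension_independent[OF this[OF order_refl]] show ?thesis
    by (simp add: type_field.exp_base_def del: type_field.Span.simps)
qed

end

section \<open>The greatest common divisor of the exponents\<close>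

lemma cong_power_of_square_eq_1:
  fixes q :: nat
  assumes "[q ^ 2 = 1] (mod g)"
  shows "[q ^ c = (if odd c then q else 1)] (mod g)"
proof -
  have even: "[q ^ (2 * k) = 1] (mod g)" for k
    using cong_pow[OF assms, of k] by (simp add: power_mult)
  show ?thesis
  proof (cases "even c")
    case True
    then show ?thesis using even[of "c div 2"] by simp
  next
    case False
    then have "c = 2 * (c div 2) + 1" by presburger
    then have "q ^ c = q ^ (2 * (c div 2)) * q" by (metis power_add power_one_right)
    then show ?thesis
      using cong_scalar_right[OF even[of "c div 2"], of q] False by simp
  qed
qed

text \<open>Doubling a Bezout relation between \<open>a\<close> and \<open>b\<close> writes 2 as a
  difference of multiples of \<open>2 * a\<close> and \<open>2 * b\<close>. For
  \<open>a = 0\<close>, coprimality forces \<open>b = 1\<close>.\<close>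

lemma cong_power_coprime_eq_1:
  fixes q a b :: nat
  assumes "coprime a b" "[q ^ (2 * a) = 1] (mod g)" "[q ^ (2 * b) = 1] (mod g)"
  shows "[q ^ 2 = 1] (mod g)"
proof (cases "a = 0")
  case True
  then show ?thesis using assms by simp
next
  case False
  then obtain x y where "a * x = b * y + 1"
    using bezout_nat[of a b] \<open>coprime a b\<close> by auto
  then have "2 * a * x = 2 * b * y + 2" by simp
  then have "(q ^ (2 * a)) ^ x = (q ^ (2 * b)) ^ y * q ^ 2"
    by (metis power_add power_mult)
  moreover have "[(q ^ (2 * a)) ^ x = 1] (mod g)"
    using cong_pow[OF assms(2), of x] by simp
  moreover have "[(q ^ (2 * b)) ^ y * q ^ 2 = q ^ 2] (mod g)"
    using cong_scalar_right[OF cong_pow[OF assms(3), of y], of "q ^ 2"] by simp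
  ultimately show ?thesis by (metis cong_sym cong_trans)
qed

text \<open>Modulo the gcd both powers are -1, so their squares are 1, and coprimality gives q^2 =
  1. Each power then reduces to \<open>q\<close> or 1 according to the parity of its
  exponent.\<close>

lemma gcd_power_plus_one_coprime:
  fixes q a b :: nat
  assumes "odd q" "coprime a b"
  shows "gcd (q ^ a + 1) (q ^ b + 1) = (if odd a \<and> odd b then q + 1 else 2)"
proof -
  let ?g = "gcd (q ^ a + 1) (q ^ b + 1)"
  have "[q ^ (2 * c) = 1] (mod ?g)" if "?g dvd q ^ c + 1" for c
  proof -
    \<comment> \<open>The factorisation of q^(2c) - 1 is carried out over the integers to avoid
      truncated subtraction.\<close>
    have "int ?g dvd (int q ^ c + 1) * (int q ^ c - 1)"
      using that by (metis dvd_mult2 int_dvd_int_iff of_nat_1 of_nat_add of_nat_power)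
    also have "(int q ^ c + 1) * (int q ^ c - 1) = int q ^ (2 * c) - 1"
      by (simp add: algebra_simps mult_2_right power_add)
    finally have "[int (q ^ (2 * c)) = int 1] (mod int ?g)"
      by (simp add: cong_iff_dvd_diff)
    then show ?thesis
      by (simp only: cong_int_iff)
  qed
  then have "[q ^ 2 = 1] (mod ?g)"
    by (intro cong_power_coprime_eq_1[OF assms(2)]) simp_all
  then have red: "?g dvd (if odd c then q else 1) + 1" if "?g dvd q ^ c + 1" for c
    using cong_add_rcancel_nat[of "q ^ c" 1 "if odd c then q else 1" ?g]
      cong_power_of_square_eq_1[of q ?g c] that cong_dvd_iff by blast
  show ?thesis
  proof (cases "odd a \<and> odd b")
    case True
    \<comment> \<open>Conversely, q^2 = 1 modulo q + 1, so odd powers of \<open>q\<close> reduce to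
      \<open>q\<close>, and q + 1 divides both numbers.\<close>
    have "int (q + 1) dvd (int q + 1) * (int q - 1)"
      by (simp add: add.commute)
    also have "(int q + 1) * (int q - 1) = int q ^ 2 - 1"
      by (simp add: algebra_simps power2_eq_square)
    finally have "[int (q ^ 2) = int 1] (mod int (q + 1))"
      by (simp add: cong_iff_dvd_diff)
    then have "[q ^ 2 = 1] (mod (q + 1))"
      by (simp only: cong_int_iff)
    then have "q + 1 dvd q ^ c + 1" if "odd c" for c
      using cong_add_rcancel_nat[of "q ^ c" 1 q "q + 1"]
        cong_power_of_square_eq_1[of q "q + 1" c] that cong_dvd_iff by fastforce
    then have "q + 1 dvd ?g" using True by simp
    moreover have "?g dvd q + 1" using red[of a] True by simp
    ultimately show ?thesis using True by (simp add: dvd_antisym)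
  next
    case False
    \<comment> \<open>An even exponent reduces its power to 1, leaving 1 + 1.\<close>
    then have "?g dvd 2" using red[of a] red[of b] by (auto simp: numeral_2_eq_2)
    moreover have "2 dvd ?g" using \<open>odd q\<close> by simp
    ultimately show ?thesis using False by (metis dvd_antisym)
  qed
qed

text \<open>Apply the coprime case to q = p^m with exponents r/m and s/m. These are not both even,
  so their difference is even exactly when both are odd.\<close>

lemma gcd_prime_power_plus_one:
  fixes p r s m :: nat
  assumes "odd p" "s \<ge> 1" "r > s" "m = gcd r s"
  shows "gcd (p ^ r + 1) (p ^ s + 1) = 2 * (if \<not> 2 * m dvd r - s then 1 else (p ^ m + 1) div 2)"
proof -
  have "m > 0" using assms by simp
  obtain a b where ab: "r = m * a" "s = m * b" "coprime a b"
    using gcd_coprime_exists[of r s] \<open>m > 0\<close> unfolding assms(4) by (metis mult.commute not_gr_zero)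
  have "r - s = m * (a - b)" by (simp add: ab diff_mult_distrib2)
  then have "2 * m dvd r - s \<longleftrightarrow> even (a - b)"
    using \<open>m > 0\<close> by (simp add: mult.commute[of 2])
  also have "\<dots> \<longleftrightarrow> odd a \<and> odd b"
  proof -
    have "b < a" using \<open>r > s\<close> ab by simp
    moreover have "\<not> (even a \<and> even b)"
      using coprime_common_divisor[OF \<open>coprime a b\<close>, of 2] by auto
    ultimately show ?thesis by auto
  qed
  finally show ?thesis
    using gcd_power_plus_one_coprime[of "p ^ m" a b] assms(1) ab by (simp add: power_mult)
qed

section \<open>The degree of a fraction\<close>

text \<open>The homomorphism \<open>h\<close> will be a change of coordinates, which makes this the
  degree in v = x - y. Numerator degree minus denominator degree does not depend on the
  representation, as \<open>fract_degree_Fract\<close> shows; the value at 0 is unspecified.\<close>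

definition fract_degree :: "('a::idom \<Rightarrow> 'b::idom poly) \<Rightarrow> 'a fract \<Rightarrow> int"
  where "fract_degree h f =
    (THE e. \<exists>a b. a \<noteq> 0 \<and> b \<noteq> 0 \<and> f = Fract a b \<and> e = int (degree (h a)) - int (degree (h b)))"

text \<open>These are the polynomials in the \<open>d\<close>-th power of the variable.\<close>

definition exponents_divisible :: "nat \<Rightarrow> 'b::idom poly \<Rightarrow> bool"
  where "exponents_divisible d p \<longleftrightarrow> (\<forall>i. coeff p i \<noteq> 0 \<longrightarrow> d dvd i)"

lemma exponents_divisible_degree: "exponents_divisible d p \<Longrightarrow> d dvd degree p"
  unfolding exponents_divisible_def by (cases "p = 0") auto

lemma exponents_divisible_const: "exponents_divisible d [:c:]"
  by (auto simp: exponents_divisible_def coeff_pCons split: nat.splits)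

lemma exponents_divisible_monom: "exponents_divisible d (monom c d)"
  by (auto simp: exponents_divisible_def coeff_monom)

lemma exponents_divisible_add:
  "exponents_divisible d p \<Longrightarrow> exponents_divisible d q \<Longrightarrow> exponents_divisible d (p + q)"
  unfolding exponents_divisible_def by (metis add.right_neutral coeff_add)

lemma exponents_divisible_uminus: "exponents_divisible d p \<Longrightarrow> exponents_divisible d (- p)"
  unfolding exponents_divisible_def by simp

lemma exponents_divisible_mult:
  assumes "exponents_divisible d p" "exponents_divisible d q"
  shows "exponents_divisible d (p * q)"
  unfolding exponents_divisible_def
proof (intro allI impI)
  fix n
  assume "coeff (p * q) n \<noteq> 0"
  then obtain i where "i \<le> n" "coeff p i * coeff q (n - i) \<noteq> 0"
    unfolding coeff_mult by (metis (no_types, lifting) atMost_iff sum.neutral)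
  then have "d dvd i" "d dvd n - i"
    using assms by (auto simp: exponents_divisible_def)
  then show "d dvd n"
    using dvd_add[of d i "n - i"] \<open>i \<le> n\<close> by simp
qed

context
  fixes h :: "'a::idom \<Rightarrow> 'b::idom poly"
  assumes hom: "comm_ring_hom h" and inj: "\<And>a. h a = 0 \<Longrightarrow> a = 0"
begin

lemma hom_add: "h (a + b) = h a + h b"
  and hom_mult: "h (a * b) = h a * h b"
  and hom_one: "h 1 = 1"
  using hom by (auto simp: comm_ring_hom_def)

lemma hom_eq_0_iff: "h a = 0 \<longleftrightarrow> a = 0"
  using inj comm_ring_hom_0[OF hom] by blast

lemma hom_uminus: "h (- a) = - h a"
  using hom_add[of a "- a"] by (simp add: comm_ring_hom_0[OF hom] eq_neg_iff_add_eq_0 add.commute)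

lemma degree_hom_mult: "a \<noteq> 0 \<Longrightarrow> b \<noteq> 0 \<Longrightarrow> degree (h (a * b)) = degree (h a) + degree (h b)"
  by (simp add: hom_mult degree_mult_eq hom_eq_0_iff)

text \<open>Cross-multiplying two representations and comparing degrees under the injective
  \<open>h\<close> gives the same difference.\<close>

lemma fract_degree_Fract:
  assumes "a \<noteq> 0" "b \<noteq> 0"
  shows "fract_degree h (Fract a b) = int (degree (h a)) - int (degree (h b))"
  unfolding fract_degree_def
proof (rule the_equality)
  fix e
  assume "\<exists>c d. c \<noteq> 0 \<and> d \<noteq> 0 \<and> Fract a b = Fract c d \<and> e = int (degree (h c)) - int (degree (h d))"
  then obtain c d where "c \<noteq> 0" "d \<noteq> 0" "a * d = c * b"
    and e: "e = int (degree (h c)) - int (degree (h d))"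
    using assms by (auto simp: eq_fract)
  then have "degree (h a) + degree (h d) = degree (h c) + degree (h b)"
    using assms degree_hom_mult[of a d] degree_hom_mult[of c b] by simp
  then show "e = int (degree (h a)) - int (degree (h b))"
    by (simp add: e)
qed (use assms in blast)

lemma fract_degree_mult:
  assumes "f \<noteq> 0" "g \<noteq> 0"
  shows "fract_degree h (f * g) = fract_degree h f + fract_degree h g"
  using assms
  by (cases f rule: Fract_cases_nonzero; cases g rule: Fract_cases_nonzero)
     (simp_all add: fract_degree_Fract degree_hom_mult)

lemma fract_degree_add:
  assumes "f \<noteq> 0" "g \<noteq> 0" "fract_degree h f \<noteq> fract_degree h g"
  shows "fract_degree h (f + g) \<in> {fract_degree h f, fract_degree h g}"
proof -
  obtain a b where f: "f = Fract a b" "a \<noteq> 0" "b \<noteq> 0"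
    using assms by (cases f rule: Fract_cases_nonzero) auto
  obtain c d where g: "g = Fract c d" "c \<noteq> 0" "d \<noteq> 0"
    using assms by (cases g rule: Fract_cases_nonzero) auto
  \<comment> \<open>Over the common denominator \<open>b * d\<close> the two numerators have
    different degrees, so their leading terms cannot cancel.\<close>
  have deg: "degree (h (a * d)) \<noteq> degree (h (c * b))"
    using assms(3) f g by (auto simp: fract_degree_Fract degree_hom_mult)
  then have "degree (h (a * d + c * b)) \<in> {degree (h (a * d)), degree (h (c * b))}"
    unfolding hom_add
    by (metis degree_add_eq_left degree_add_eq_right insertCI linorder_neqE_nat)
  moreover have "a * d + c * b \<noteq> 0"
  proof
    assume "a * d + c * b = 0"
    then have "h (a * d) = - h (c * b)"
      by (metis eq_neg_iff_add_eq_0 hom_uminus)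
    then show False using deg by simp
  qed
  ultimately show ?thesis
    using f g by (auto simp: fract_degree_Fract degree_hom_mult)
qed

text \<open>For the coordinate change constructed below this field is k(u, v^d). It serves as an
  upper bound for the field generated by the power sums.\<close>

lemma subfield_exponents_divisible:
  "subfield {Fract a b | a b. b \<noteq> 0 \<and> exponents_divisible d (h a) \<and> exponents_divisible d (h b)}
    ring_of_type_algebra" (is "subfield ?H _")
proof -
  have one: "1 \<in> ?H"
    using exponents_divisible_const[of d 1] by (force simp: One_fract_def hom_one simp flip: one_pCons)
  have closed: "f + g \<in> ?H" "f * g \<in> ?H" "- f \<in> ?H" "inverse f \<in> ?H"
    if f: "f \<in> ?H" and g: "g \<in> ?H" for f g
  proof -
    obtain a b where f: "f = Fract a b" "b \<noteq> 0" "exponents_divisible d (h a)" "exponents_divisible d (h b)"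
      using f by blast
    obtain a' b' where g: "g = Fract a' b'" "b' \<noteq> 0" "exponents_divisible d (h a')" "exponents_divisible d (h b')"
      using g by blast
    have "f + g = Fract (a * b' + a' * b) (b * b')" "f * g = Fract (a * a') (b * b')"
      "- f = Fract (- a) b"
      using f g by simp_all
    then show "f + g \<in> ?H" "f * g \<in> ?H" "- f \<in> ?H"
      using f g
      by (auto intro!: exI simp: hom_add hom_mult hom_uminus exponents_divisible_add
          exponents_divisible_mult exponents_divisible_uminus)
    show "inverse f \<in> ?H"
    proof (cases "a = 0")
      case True
      then have "inverse f = f" using f by (simp add: fract_collapse)
      then show ?thesis using f by blast
    next
      case False
      then show ?thesis using f by auto
    qed
  qed
  show ?thesis
    unfolding subfield_type_iff
    by (intro conjI ballI one; rule closed; assumption)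
qed

lemma fract_degree_exponents_divisible:
  assumes "f \<in> {Fract a b | a b. b \<noteq> 0 \<and> exponents_divisible d (h a) \<and> exponents_divisible d (h b)}"
    and "f \<noteq> 0"
  shows "int d dvd fract_degree h f"
proof -
  obtain a b where "f = Fract a b" "b \<noteq> 0" "exponents_divisible d (h a)" "exponents_divisible d (h b)"
    using assms(1) by blast
  moreover from this have "a \<noteq> 0" using assms(2) by (auto simp: fract_collapse)
  ultimately show ?thesis
    by (simp add: fract_degree_Fract exponents_divisible_degree)
qed

end

section \<open>The coordinates x + y and x - y\<close>

text \<open>Substitution of \<open>U\<close> for x and \<open>V\<close> for y;
  \<open>swap_poly2\<close> is the case U = y, V = x.\<close>

definition poly2_subst :: "'k::field poly poly \<Rightarrow> 'k poly poly \<Rightarrow> 'k poly poly \<Rightarrow> 'k poly poly"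
  where "poly2_subst U V p =
    poly (map_poly (\<lambda>c. poly (map_poly (\<lambda>a. [:[:a:]:]) c) U) p) V"

lemma comm_ring_hom_poly2_subst: "comm_ring_hom (poly2_subst U V)"
proof -
  have "comm_ring_hom (\<lambda>a::'k::field. [:[:a:]:])"
    by (simp add: comm_ring_hom_def one_pCons)
  from comm_ring_hom_eval[OF comm_ring_hom_eval[OF this]] show ?thesis
    unfolding poly2_subst_def[abs_def] .
qed

lemma poly2_subst_simps:
  "poly2_subst U V [:[:c:]:] = [:[:c:]:]"
  "poly2_subst U V [:[:0, 1:]:] = U"
  "poly2_subst U V [:0, 1:] = V"
  by (simp_all add: poly2_subst_def map_poly_pCons map_poly_1' flip: one_pCons)

text \<open>The substitution x -> (x + y)/2, y -> (x - y)/2 turns u into x and v into y, so the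
  degree in v becomes the degree in the outer variable. It is injective because x -> x + y, y -> x -
  y undoes it.\<close>

lemma diagonalizing_hom_exists:
  assumes "(2::'k::field) \<noteq> 0"
  obtains h :: "'k::field poly poly \<Rightarrow> 'k poly poly" where "comm_ring_hom h" "\<And>a. h a = 0 \<Longrightarrow> a = 0"
    "\<And>c. h [:[:c:]:] = [:[:c:]:]"
    "h ([:[:0, 1:]:] + [:0, 1:]) = [:[:0, 1:]:]" "h ([:[:0, 1:]:] - [:0, 1:]) = [:0, 1:]"
proof
  let ?x = "[:[:0, 1:]:] :: 'k poly poly" and ?y = "[:0, 1:] :: 'k poly poly"
  let ?half = "[:[:1 / 2:]:] :: 'k poly poly"
  let ?h = "poly2_subst (?half * (?x + ?y)) (?half * (?x - ?y))"
  let ?g = "poly2_subst (?x + ?y) (?x - ?y)"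
  show hom: "comm_ring_hom ?h" by (rule comm_ring_hom_poly2_subst)
  show "?h [:[:c:]:] = [:[:c:]:]" for c by (rule poly2_subst_simps)
  have h: "?h (a + b) = ?h a + ?h b" "?h (a - b) = ?h a - ?h b" for a b
  proof -
    show add: "?h (a + b) = ?h a + ?h b" for a b
      using hom by (simp add: comm_ring_hom_def)
    show "?h (a - b) = ?h a - ?h b"
      using add[of "a - b" b] by simp
  qed
  have half: "?half * a + ?half * a = a" for a
  proof -
    have "?half + ?half = 1" using assms by (simp add: one_pCons)
    then show ?thesis by (metis distrib_right mult_1)
  qed
  have half1: "?half * (a + b) + ?half * (a - b) = a" "?half * (a + b) - ?half * (a - b) = b" for a b
    using half[of a] half[of b] by (simp_all only: distrib_left right_diff_distrib) simp_all
  show "?h (?x + ?y) = ?x" "?h (?x - ?y) = ?y"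
    unfolding h poly2_subst_simps by (rule half1)+
  have g: "comm_ring_hom ?g" by (rule comm_ring_hom_poly2_subst)
  have g_simps: "?g (a + b) = ?g a + ?g b" "?g (a * b) = ?g a * ?g b" "?g (a - b) = ?g a - ?g b" for a b
  proof -
    show add: "?g (a + b) = ?g a + ?g b" "?g (a * b) = ?g a * ?g b" for a b
      using g by (simp_all add: comm_ring_hom_def)
    show "?g (a - b) = ?g a - ?g b"
      using add(1)[of "a - b" b] by simp
  qed
  have "?g (?h p) = p" for p
  proof (rule comm_ring_hom_poly2_eqI[where f = "\<lambda>p. ?g (?h p)" and g = "\<lambda>p. p"])
    show "comm_ring_hom (\<lambda>p. ?g (?h p))" by (rule comm_ring_hom_comp[OF g hom])
    show "comm_ring_hom (\<lambda>p::'k poly poly. p)" by (simp add: comm_ring_hom_def)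
    show "?g (?h [:[:c:]:]) = [:[:c:]:]" for c by (simp only: poly2_subst_simps)
    have "?half * ((a + b) + (a - b)) = a" "?half * ((a + b) - (a - b)) = b" for a b
      using half1[of a b] by (simp_all only: distrib_left right_diff_distrib)
    then show "?g (?h ?x) = ?x" "?g (?h ?y) = ?y"
      unfolding poly2_subst_simps g_simps by blast+
  qed
  then show "?h a = 0 \<Longrightarrow> a = 0" for a
    by (metis comm_ring_hom_0[OF g])
qed

section \<open>Subfields of F containing k\<close>

lemma to_fract_in_subfield:
  assumes H: "subfield H ratfun2_field" and "range ratfun2_const \<subseteq> H"
    and X: "ratfun2_X \<in> H" and Y: "ratfun2_Y \<in> H"
  shows "to_fract p \<in> H"
proof -
  have c: "to_fract [:[:c:]:] \<in> H" for c
    using assms(2) by (auto simp: ratfun2_const_def)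
  have inner: "to_fract [:q:] \<in> H" for q
  proof (induction q)
    case 0
    then show ?case using subfield_zero[OF H] by simp
  next
    case (pCons a q)
    have "[:pCons a q:] = [:[:a:]:] + [:[:0, 1:]:] * [:q:]" by simp
    then show ?case
      using pCons c X subfield_add[OF H] subfield_mult[OF H]
      by (simp only: to_fract_add to_fract_mult ratfun2_X_def)
  qed
  show ?thesis
  proof (induction p)
    case 0
    then show ?case using subfield_zero[OF H] by simp
  next
    case (pCons a p)
    have "pCons a p = [:a:] + [:0, 1:] * p" by simp
    then show ?case
      using pCons inner Y subfield_add[OF H] subfield_mult[OF H]
      by (simp only: to_fract_add to_fract_mult ratfun2_Y_def)
  qed
qed

lemma subfield_eq_UNIV:
  assumes "subfield H ratfun2_field" "range ratfun2_const \<subseteq> H" "ratfun2_X \<in> H" "ratfun2_Y \<in> H"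
  shows "H = UNIV"
proof -
  have "f \<in> H" for f
  proof (cases f)
    case (Fract a b)
    then have "f = to_fract a / to_fract b" by (simp add: to_fract_def)
    then show ?thesis
      using to_fract_in_subfield[OF assms] subfield_divide[OF assms(1)] by simp
  qed
  then show ?thesis by blast
qed

lemma subfield_adjoin: "subfield (adjoin A) ratfun2_field"
  unfolding adjoin_def
  by (rule field.generate_field_is_subfield[OF field_from_type_algebra]) (simp add: type_field_simps)

lemma const_in_adjoin: "range ratfun2_const \<subseteq> adjoin A"
  and adjoin_incl: "A \<subseteq> adjoin A"
  unfolding adjoin_def by (auto intro: generate_field.incl)

lemma adjoin_subset:
  "subfield H ratfun2_field \<Longrightarrow> range ratfun2_const \<subseteq> H \<Longrightarrow> A \<subseteq> H \<Longrightarrow> adjoin A \<subseteq> H"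
  unfolding adjoin_def
  by (rule field.generate_field_min_subfield1[OF field_from_type_algebra]) (simp_all add: type_field_simps)

section \<open>The exchange automorphism and its fixed field\<close>

lemma exchange_automorphism_simps:
  "exchange_automorphism 1 = 1"
  "exchange_automorphism (a + b) = exchange_automorphism a + exchange_automorphism b"
  "exchange_automorphism (a * b) = exchange_automorphism a * exchange_automorphism b"
  "exchange_automorphism (ratfun2_const c) = ratfun2_const c"
  "exchange_automorphism ratfun2_X = ratfun2_Y" "exchange_automorphism ratfun2_Y = ratfun2_X"
  using is_exchange_automorphism_exchange_automorphism by (auto simp: is_exchange_automorphism_alt)

lemma exchange_automorphism_power: "exchange_automorphism (a ^ n) = exchange_automorphism a ^ n"
  by (induction n) (simp_all add: exchange_automorphism_simps)

lemma exchange_automorphism_0: "exchange_automorphism 0 = 0"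
  by (metis exchange_automorphism_simps(2) add_0 add_cancel_right_right)

lemma exchange_automorphism_uminus: "exchange_automorphism (- a) = - exchange_automorphism a"
  using exchange_automorphism_simps(2)[of a "- a"]
  by (simp add: exchange_automorphism_0 eq_neg_iff_add_eq_0 add.commute)

lemma subfield_symmetric_ratfuns: "subfield symmetric_ratfuns ratfun2_field"
  unfolding subfield_type_iff symmetric_ratfuns_def
proof (intro conjI ballI; clarsimp simp: exchange_automorphism_simps exchange_automorphism_uminus)
  fix a :: "'a ratfun2"
  assume a: "exchange_automorphism a = a"
  show "exchange_automorphism (inverse a) = inverse a"
  proof (cases "a = 0")
    case False
    then have "a * exchange_automorphism (inverse a) = 1"
      using exchange_automorphism_simps(3)[of a "inverse a"] a by (simp add: exchange_automorphism_simps)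
    then show ?thesis by (rule inverse_unique[symmetric])
  qed (simp add: exchange_automorphism_0)
qed

lemma const_in_symmetric_ratfuns: "range ratfun2_const \<subseteq> symmetric_ratfuns"
  by (auto simp: symmetric_ratfuns_def exchange_automorphism_simps)

lemma power_sum2_in_symmetric_ratfuns: "power_sum2 j \<in> symmetric_ratfuns"
  by (simp add: symmetric_ratfuns_def power_sum2_def exchange_automorphism_simps
      exchange_automorphism_power add.commute)

text \<open>Raising to the power \<open>q\<close> is additive, and in (x + y)(x^q + y^q) + (x -
  y)(x^q - y^q) the mixed terms cancel.\<close>

lemma power_sum_frobenius:
  fixes x y :: "'a::comm_ring_1"
  assumes "prime CHAR('a)" and q: "q = CHAR('a) ^ n"
  shows "2 * (x ^ (q + 1) + y ^ (q + 1)) = (x + y) ^ (q + 1) + (x - y) ^ (q + 1)"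
proof -
  have add: "(x + y) ^ q = x ^ q + y ^ q"
    by (rule freshmans_dream'[OF assms])
  have diff: "(x - y) ^ q = x ^ q - y ^ q"
    using freshmans_dream'[OF assms, of "x - y" y] by simp
  show ?thesis
    by (simp add: add diff algebra_simps)
qed

text \<open>Lets the Frobenius identity be used in F itself.\<close>

lemma CHAR_fract: "CHAR('a::idom fract) = CHAR('a)"
  by (rule CHAR_eqI) (simp_all add: of_nat_fract eq_fract Zero_fract_def of_nat_eq_0_iff_char_dvd)

text \<open>Stated for arbitrary exponents, since only half the gcd of the two numbers enters the
  degree.\<close>

lemma dimension_symmetric_ratfuns:
  fixes i j n :: nat
  assumes p: "prime CHAR('k::field)" "odd CHAR('k)"
    and n: "gcd (CHAR('k) ^ i + 1) (CHAR('k) ^ j + 1) = 2 * n"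
  shows "type_field.dimension n
    (adjoin {power_sum2 (CHAR('k) ^ i + 1), power_sum2 (CHAR('k) ^ j + 1), power_sum2 1})
    (symmetric_ratfuns :: 'k ratfun2 set)"
proof -
  let ?q = "CHAR('k) ^ i" and ?r = "CHAR('k) ^ j"
  define K :: "'k ratfun2 set"
    where "K = adjoin {power_sum2 (?q + 1), power_sum2 (?r + 1), power_sum2 1}"
  define u v :: "'k ratfun2" where "u = ratfun2_X + ratfun2_Y" and "v = ratfun2_X - ratfun2_Y"
  have K: "subfield K ratfun2_field"
    unfolding K_def by (rule subfield_adjoin)
  have gens: "power_sum2 (?q + 1) \<in> K" "power_sum2 (?r + 1) \<in> K" "u \<in> K"
    using adjoin_incl[of "{power_sum2 (?q + 1), power_sum2 (?r + 1), power_sum2 1 :: 'k ratfun2}"]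
    by (simp_all add: K_def u_def power_sum2_def)
  have "n > 0"
    using n by (metis gcd_eq_0_iff gr0I mult_0_right Suc_eq_plus1 nat.distinct(1))
  have CHAR: "CHAR('k ratfun2) = CHAR('k)"
    by (simp add: CHAR_fract)
  have "\<not> CHAR('k) dvd 2"
    using p by (metis primes_dvd_imp_eq two_is_prime_nat)
  then have two: "(2::'k) \<noteq> 0" "(2 :: 'k ratfun2) \<noteq> 0"
    using of_nat_eq_0_iff_char_dvd[of 2, where 'a = 'k]
      of_nat_eq_0_iff_char_dvd[of 2, where 'a = "'k ratfun2"] CHAR by simp_all
  have power_sum: "2 * power_sum2 (CHAR('k) ^ l + 1) = u ^ (CHAR('k) ^ l + 1) + v ^ (CHAR('k) ^ l + 1)" for l
    unfolding u_def v_def power_sum2_def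
    by (rule power_sum_frobenius[of _ l]) (simp_all add: CHAR p)

  have sym_v: "exchange_automorphism v = - v"
    using exchange_automorphism_simps(2)[of ratfun2_X "- ratfun2_Y :: 'k ratfun2"]
    by (simp add: v_def exchange_automorphism_simps exchange_automorphism_uminus)
  have K_sym: "K \<subseteq> symmetric_ratfuns"
    unfolding K_def
    by (rule adjoin_subset[OF subfield_symmetric_ratfuns const_in_symmetric_ratfuns])
       (simp add: power_sum2_in_symmetric_ratfuns)
  have "v\<^sup>2 \<in> symmetric_ratfuns"
    by (simp add: symmetric_ratfuns_def exchange_automorphism_power sym_v)
  then have span_sym: "power_span K (v\<^sup>2) n \<subseteq> symmetric_ratfuns"
    by (rule power_span_subset[OF K K_sym _ subfield_symmetric_ratfuns])

  obtain h :: "'k poly poly \<Rightarrow> 'k poly poly" where hom: "comm_ring_hom h" and inj: "\<And>a. h a = 0 \<Longrightarrow> a = 0"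
    and h: "\<And>c. h [:[:c:]:] = [:[:c:]:]"
    "h ([:[:0, 1:]:] + [:0, 1:]) = [:[:0, 1:]:]" "h ([:[:0, 1:]:] - [:0, 1:]) = [:0, 1:]"
    using diagonalizing_hom_exists[OF two(1)] by blast
  have v_Fract: "v = Fract ([:[:0, 1:]:] - [:0, 1:]) 1" and u_Fract: "u = Fract ([:[:0, 1:]:] + [:0, 1:]) 1"
    by (simp_all add: u_def v_def ratfun2_X_def ratfun2_Y_def to_fract_def)
  have "[:[:0, 1:]:] - [:0, 1:] \<noteq> (0 :: 'k poly poly)"
    using h(3) comm_ring_hom_0[OF hom] by force
  then have "v \<noteq> 0" and deg_v: "fract_degree h v = 1"
    using h(3) hom_one[OF hom inj] unfolding v_Fract
    by (simp_all add: eq_fract Zero_fract_def fract_degree_Fract[OF hom inj])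

  have "v ^ (CHAR('k) ^ l + 1) \<in> K" if "power_sum2 (CHAR('k) ^ l + 1) \<in> K" for l
  proof -
    have eq: "v ^ (CHAR('k) ^ l + 1) = power_sum2 (CHAR('k) ^ l + 1) + power_sum2 (CHAR('k) ^ l + 1) - u ^ (CHAR('k) ^ l + 1)"
      using power_sum[of l] by (simp add: algebra_simps)
    show ?thesis
      unfolding eq by (intro subfield_diff[OF K] subfield_add[OF K] subfield_power[OF K] that gens(3))
  qed
  \<comment> \<open>Both v^(q+1) and v^(r+1) lie in \<open>K\<close>, hence so does the power of
    \<open>v\<close> whose exponent is their gcd.\<close>
  from subfield_power_gcd[OF K \<open>v \<noteq> 0\<close> this[OF gens(1)] this[OF gens(2)]]
  have v_power: "v ^ (2 * n) \<in> K" by (simp only: n)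

  have "symmetric_ratfuns \<subseteq> power_span K (v\<^sup>2) n"
  proof
    fix f :: "'k ratfun2"
    assume f: "f \<in> symmetric_ratfuns"
    let ?L = "type_field.simple_extension K v"
    have L: "subfield ?L ratfun2_field"
      using subfield_simple_extension_root[OF K v_power] \<open>n > 0\<close> by simp
    have K_L: "K \<subseteq> ?L" and v_L: "v \<in> ?L"
      using type_field.simple_extension_incl[of K v] type_field.simple_extension_mem[of K v]
        subfieldE(1)[OF K] by (simp_all add: type_field_simps)
    have const_L: "range ratfun2_const \<subseteq> ?L"
      using K_L const_in_adjoin by (force simp: K_def)
    \<comment> \<open>Halving u + v and u - v recovers x and y, so K[v] is all of F.\<close>
    have "inverse 2 \<in> ?L"
      using subfield_inverse[OF L subfield_add[OF L subfield_one[OF L] subfield_one[OF L]]] by simp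
    then have "inverse 2 * (u + v) \<in> ?L" "inverse 2 * (u - v) \<in> ?L"
      using gens(3) K_L v_L subfield_add[OF L] subfield_diff[OF L] subfield_mult[OF L] by blast+
    moreover have "u + v = 2 * ratfun2_X" "u - v = 2 * ratfun2_Y"
      by (simp_all add: u_def v_def)
    ultimately have "ratfun2_X \<in> ?L" "ratfun2_Y \<in> ?L"
      using two(2) by (simp_all add: mult.assoc[symmetric])
    then have "f \<in> ?L"
      using subfield_eq_UNIV[OF L const_L] by simp
    then obtain e e' where e: "e \<in> power_span K (v\<^sup>2) n" "e' \<in> power_span K (v\<^sup>2) n" "f = e + v * e'"
      using simple_extension_even_odd[OF K _ \<open>n > 0\<close>, of v f] v_power by (auto simp: power_mult)
    \<comment> \<open>The even powers of \<open>v\<close> are symmetric and \<open>v\<close> changes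
      sign, so the odd part of a symmetric \<open>f\<close> vanishes.\<close>
    have "exchange_automorphism f = f" "exchange_automorphism e = e" "exchange_automorphism e' = e'"
      using e f span_sym by (auto simp: symmetric_ratfuns_def simp del: type_field.Span.simps)
    then have "e - v * e' = e + v * e'"
      using e(3) by (simp add: exchange_automorphism_simps sym_v)
    then have "2 * (v * e') = 0" by (simp add: algebra_simps)
    then have "f = e" using e(3) two(2) by simp
    then show "f \<in> power_span K (v\<^sup>2) n" using e(1) by simp
  qed
  with span_sym have sym: "symmetric_ratfuns = power_span K (v\<^sup>2) n" by blast

  \<comment> \<open>It remains to prove independence. This subfield contains \<open>K\<close>, and
    its nonzero elements have degree in \<open>v\<close> divisible by 2n.\<close>
  let ?H = "{Fract a b | a b. b \<noteq> 0 \<and> exponents_divisible (2 * n) (h a) \<and> exponents_divisible (2 * n) (h b)}"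
  have H: "subfield ?H ratfun2_field"
    by (rule subfield_exponents_divisible[OF hom inj])
  have Fract_H: "Fract a 1 \<in> ?H" if "exponents_divisible (2 * n) (h a)" for a
    using that exponents_divisible_const[of "2 * n" 1] hom_one[OF hom inj] by (force simp flip: one_pCons)
  have const_H: "range ratfun2_const \<subseteq> ?H"
    using Fract_H h(1) by (auto simp: ratfun2_const_def to_fract_def exponents_divisible_const)
  have u_H: "u \<in> ?H"
    using Fract_H h(2) by (simp add: u_Fract exponents_divisible_const)
  have "v ^ (2 * n) \<in> ?H"
  proof -
    have "h (a ^ k) = h a ^ k" for a k
      by (induction k) (simp_all add: hom_one[OF hom inj] hom_mult[OF hom inj])
    moreover have "[:0, 1:] ^ (2 * n) = monom (1 :: 'k poly) (2 * n)"
      by (simp add: monom_altdef)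
    ultimately have "exponents_divisible (2 * n) (h (([:[:0, 1:]:] - [:0, 1:]) ^ (2 * n)))"
      by (simp only: h exponents_divisible_monom)
    moreover have "Fract a 1 ^ k = Fract (a ^ k) 1" for a :: "'k poly poly" and k
      by (induction k) (simp_all add: One_fract_def)
    ultimately show ?thesis using Fract_H by (simp add: v_Fract)
  qed
  note v_power_H = subfield_power[OF H this]
  have "v ^ k \<in> ?H" if k: "2 * n dvd k" for k
  proof -
    obtain l where "k = 2 * n * l" using k ..
    then have "v ^ k = (v ^ (2 * n)) ^ l" by (simp only: power_mult)
    then show ?thesis using v_power_H by (simp only:)
  qed
  moreover have "2 * n dvd ?q + 1" "2 * n dvd ?r + 1"
    by (simp_all flip: n)
  ultimately have v_H: "v ^ (?q + 1) \<in> ?H" "v ^ (?r + 1) \<in> ?H"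
    by blast+
  have "power_sum2 (CHAR('k) ^ l + 1) \<in> ?H" if "v ^ (CHAR('k) ^ l + 1) \<in> ?H" for l
  proof -
    \<comment> \<open>The denominator 1 + 1 makes membership follow from closure under
      addition.\<close>
    have eq: "power_sum2 (CHAR('k) ^ l + 1) = (u ^ (CHAR('k) ^ l + 1) + v ^ (CHAR('k) ^ l + 1)) / (1 + 1)"
      using power_sum[of l] two(2) by (simp add: field_simps)
    show ?thesis
      unfolding eq
      by (intro subfield_divide[OF H] subfield_add[OF H] subfield_power[OF H] subfield_one[OF H] that u_H)
  qed
  then have "K \<subseteq> ?H"
    unfolding K_def using v_H u_H
    by (intro adjoin_subset[OF H const_H]) (simp add: power_sum2_def u_def)
  then have deg_K: "int (2 * n) dvd fract_degree h c" if "c \<in> K" "c \<noteq> 0" for c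
    using fract_degree_exponents_divisible[OF hom inj, of c "2 * n"] that by blast
  have deg_w: "fract_degree h (v\<^sup>2) = 2"
    unfolding power2_eq_square using fract_degree_mult[OF hom inj, of v v] \<open>v \<noteq> 0\<close> deg_v by simp
  have "type_field.dimension n K (power_span K (v\<^sup>2) n)"
  \<comment> \<open>As v^2 has degree 2, the required modulus n * deg(v^2) is exactly 2n.\<close>
  proof (rule dimension_power_span[OF K, where deg = "fract_degree h"])
    show "int n * fract_degree h (v\<^sup>2) dvd fract_degree h c" if "c \<in> K" "c \<noteq> 0" for c
      using deg_K[OF that] by (simp add: deg_w mult.commute)
  qed (use fract_degree_mult[OF hom inj] fract_degree_add[OF hom inj] \<open>v \<noteq> 0\<close> deg_w in auto)
  then show ?thesis
    by (simp only: sym K_def)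
qed

text \<open>The field degree is expressed as the dimension of S as a vector space over the generated
  subfield; its value is half the gcd of the two exponents.\<close>

theorem mainTheorem3:
  fixes p r s m :: nat
  assumes "prime p" and "odd p" and "CHAR('k::field) = p"
    and "s \<ge> 1" and "r > s" and "m = gcd r s"
  shows "ring.dimension (ratfun2_field :: 'k ratfun2 ring)
    (if \<not> 2 * m dvd r - s then 1 else (p ^ m + 1) div 2)
    (adjoin {power_sum2 (p ^ r + 1), power_sum2 (p ^ s + 1), power_sum2 1})
    symmetric_ratfuns"
  using dimension_symmetric_ratfuns[where 'k = 'k, of r s]
    gcd_prime_power_plus_one[OF assms(2,4-6)] assms(1-3) by simp

end
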